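(* Let $r>0$ and let $E\subseteq\mathbb{R}^n$ be such that for every ball $B\subseteq\mathbb{R}^n$ and for any measurable set $F\subseteq\mathbb{R}^n$ with $F\setminus B=E\setminus B$ it holds that $$\mathrm{Per}_r(E,B)\le \mathrm{Per}_r(F,B).$$ Then either $E=\varnothing$ or $E=\mathbb{R}^n$.
   Context: $B_\rho(x)$ is the ball of radius $\rho$ centered at $x$ in $\mathbb{R}^n$, and $\mathcal{L}^n$ is the $n$-dimensional Lebesgue measure. For a set $A\subseteq\mathbb{R}^n$, $A\oplus B_r:=\bigcup_{x\in A}B_r(x)$. A measurable set $E$ is identified with its set of points of density one (so equalities and inclusions of sets are understood up to null sets), and $\partial E$ denotes the topological boundary of the set of points of density one of $E$. For a domain $\Omega\subseteq\mathbb{R}^n$ and measurable $E\subseteq\mathbb{R}^n$, the $r$-perimeter of $E$ in $\Omega$ is $$\mathrm{Per}_r(E,\Omega):=\frac{1}{2r}\mathcal{L}^n\Big(\big((\partial E)\oplus B_r\big)\cap\Omega\Big).$$ *)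

theory Defs
  imports "HOL-Analysis.Analysis"
begin

definition density_one_points :: "(real ^ 'n) set \<Rightarrow> (real ^ 'n) set" where
  "density_one_points E =
     {x. ((\<lambda>\<rho>. measure lebesgue (E \<inter> ball x \<rho>) / measure lebesgue (ball x \<rho>)) \<longlongrightarrow> 1) (at_right 0)}"

text \<open>Equality of sets up to Lebesgue null sets.\<close>

definition eq_ae :: "(real ^ 'n) set \<Rightarrow> (real ^ 'n) set \<Rightarrow> bool" where
  "eq_ae A B \<longleftrightarrow> (A - B) \<union> (B - A) \<in> null_sets lebesgue"

text \<open>The boundary of a measurable set, where the set is identified with its points of
  density one; it is therefore invariant under modifications on null sets,
  unlike \<open>frontier E\<close>, but it is a topological boundary, not the reduced or measure-theoretic one.\<close>

definition density_boundary :: "(real ^ 'n) set \<Rightarrow> (real ^ 'n) set" where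
  "density_boundary E = frontier (density_one_points E)"

definition ball_enlargement :: "(real ^ 'n) set \<Rightarrow> real \<Rightarrow> (real ^ 'n) set" where
  "ball_enlargement A r = (\<Union>x\<in>A. ball x r)"

text \<open>The values are extended nonnegative reals, since \<open>\<Omega>\<close> may be unbounded.\<close>

definition Per :: "real \<Rightarrow> (real ^ 'n) set \<Rightarrow> (real ^ 'n) set \<Rightarrow> ennreal" where
  "Per r E \<Omega> = emeasure lebesgue (ball_enlargement (density_boundary E) r \<inter> \<Omega>) / ennreal (2 * r)"

end

theory Submission
  imports Defs
begin

text \<open>
  Write \<open>\<Gamma>\<close> for the density boundary of \<open>E\<close>. By Lebesgue's density theorem, \<open>\<Gamma>\<close> consists of the
  points all of whose neighbourhoods meet both \<open>E\<close> and its complement in positive measure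
  (\<open>density_boundary_eq\<close>). Its complement is therefore the disjoint union of two open sets: the
  points near which \<open>E\<close> is null and those near which its complement is null. If \<open>\<Gamma>\<close> is empty, then
  connectedness of the space makes one of these sets the whole space, so that \<open>E\<close> is trivial.

  Suppose that \<open>\<Gamma>\<close> is nonempty. Either every point lies at distance less than \<open>r\<close> from \<open>\<Gamma>\<close>, and then
  take any \<open>c\<close>, or the intermediate value theorem yields \<open>c\<close> at distance exactly \<open>r\<close> from \<open>\<Gamma>\<close>.
  After replacing \<open>E\<close> by its complement if necessary, \<open>E\<close> is not full near \<open>c\<close>. The competitor is
  \<open>E - B\<close> with \<open>B = ball c (2 * r)\<close> (for the complement, this means filling \<open>B\<close> instead of
  emptying it). Two observations show that it has strictly smaller \<open>r\<close>-perimeter in \<open>B\<close>: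

  \<^item> Nothing is gained. New boundary appears only on the sphere, at points \<open>q\<close> near which \<open>E\<close> is full.
    Let \<open>x \<in> B\<close> be within \<open>r\<close> of such a \<open>q\<close>. If \<open>E\<close> is not full near \<open>x\<close>, then the segment from \<open>x\<close>
    to \<open>q\<close> crosses \<open>\<Gamma>\<close>. If it is, then the segment from \<open>x\<close> to \<open>c\<close> crosses \<open>\<Gamma>\<close>, and the crossing
    point has distance at least \<open>r\<close> from \<open>c\<close>, hence less than \<open>r\<close> from \<open>x\<close>. So \<open>x\<close> was within \<open>r\<close>
    of \<open>\<Gamma>\<close> already, as it trivially is when every point lies that close to \<open>\<Gamma>\<close>.

  \<^item> Something is lost. \<open>E - B\<close> has no boundary in \<open>B\<close>, so no point of \<open>ball c r\<close> is within \<open>r\<close> of the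
    new boundary, whereas a nonempty open subset of \<open>ball c r\<close> was within \<open>r\<close> of \<open>\<Gamma>\<close>.
\<close>

section \<open>Lebesgue density\<close>

text \<open>
  This is the covering step of the density theorem. Choose an open \<open>U \<supseteq> E\<close> with \<open>U - E\<close> of tiny
  measure. Vitali's theorem covers almost all of \<open>S\<close> by disjoint balls inside \<open>U\<close>, each having a
  fixed fraction of its volume in \<open>U - E\<close>; so their total volume is tiny.
\<close>

lemma frequently_dense_complement_negligible:
  fixes E :: "'a::euclidean_space set"
  assumes E: "E \<in> sets lebesgue" and "k > 0"
    and S: "S \<subseteq> E"
    and dense: "\<And>x d. x \<in> S \<Longrightarrow> 0 < d \<Longrightarrow>
      \<exists>\<rho>. 0 < \<rho> \<and> \<rho> < d \<and> measure lebesgue (ball x \<rho>) \<le> k * measure lebesgue (ball x \<rho> - E)"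
  shows "negligible S"
  unfolding negligible_outer
proof (intro allI impI)
  fix e :: real
  assume "e > 0"
  then have "e / (2 * k) > 0" using \<open>k > 0\<close> by simp
  then obtain U where U: "open U" "E \<subseteq> U" "U - E \<in> lmeasurable"
      and "emeasure lebesgue (U - E) < ennreal (e / (2 * k))"
    using sets_lebesgue_outer_open [OF E] by metis
  then have mU: "measure lebesgue (U - E) < e / (2 * k)"
    by (metis emeasure_eq_measure2 ennreal_leI linorder_not_le)
  define K where "K = {(x, \<rho>). 0 < \<rho> \<and> ball x \<rho> \<subseteq> U \<and>
      measure lebesgue (ball x \<rho>) \<le> k * measure lebesgue (ball x \<rho> - E)}"
  have fine: "\<exists>i. i \<in> K \<and> x \<in> ball (fst i) (snd i) \<and> snd i < d" if "x \<in> S" "0 < d" for x d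
  proof -
    obtain b where b: "b > 0" "ball x b \<subseteq> U"
      using U S \<open>x \<in> S\<close> by (meson openE subsetD)
    obtain \<rho> where "0 < \<rho>" "\<rho> < min b d"
        "measure lebesgue (ball x \<rho>) \<le> k * measure lebesgue (ball x \<rho> - E)"
      using dense [OF \<open>x \<in> S\<close>, of "min b d"] b \<open>0 < d\<close> by auto
    moreover have "ball x \<rho> \<subseteq> U"
      using b \<open>\<rho> < min b d\<close> by (meson min_less_iff_conj less_imp_le order_trans subset_ball)
    ultimately show ?thesis
      by (intro exI [of _ "(x, \<rho>)"]) (auto simp: K_def)
  qed
  obtain C where C: "countable C" "C \<subseteq> K"
      and disj: "pairwise (\<lambda>i j. disjnt (ball (fst i) (snd i)) (ball (fst j) (snd j))) C"
      and cov: "negligible (S - (\<Union>i\<in>C. ball (fst i) (snd i)))"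
    using fine by (rule Vitali_covering_theorem_balls [of S K fst snd])
  define W where "W = (\<Union>i\<in>C. ball (fst i) (snd i))"
  have bound: "measure lebesgue (\<Union>i\<in>I. ball (fst i) (snd i)) \<le> e / 2"
    if I: "I \<subseteq> C" "finite I" for I
  proof -
    have dI: "pairwise (\<lambda>i j. disjnt (ball (fst i) (snd i)) (ball (fst j) (snd j))) I"
      using disj I(1) by (rule pairwise_subset)
    have lm: "ball (fst i) (snd i) - E \<in> lmeasurable" for i :: "'a \<times> real"
      using E by (simp add: fmeasurable.Diff fmeasurable_Diff)
    have "measure lebesgue (\<Union>i\<in>I. ball (fst i) (snd i))
        \<le> (\<Sum>i\<in>I. measure lebesgue (ball (fst i) (snd i)))"
      using I(2) by (intro measure_UNION_le) auto
    also have "\<dots> \<le> (\<Sum>i\<in>I. k * measure lebesgue (ball (fst i) (snd i) - E))"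
      using I(1) C(2) by (intro sum_mono) (auto simp: K_def)
    also have "\<dots> = k * (\<Sum>i\<in>I. measure lebesgue (ball (fst i) (snd i) - E))"
      by (simp add: sum_distrib_left)
    also have "(\<Sum>i\<in>I. measure lebesgue (ball (fst i) (snd i) - E))
        = measure lebesgue (\<Union>i\<in>I. ball (fst i) (snd i) - E)"
    proof (rule measure_UNION_AE [symmetric, OF I(2) lm], rule pairwiseI)
      fix i j assume "i \<in> I" "j \<in> I" "i \<noteq> j"
      then have "disjnt (ball (fst i) (snd i)) (ball (fst j) (snd j))"
        using dI by (auto simp: pairwise_def)
      then show "AE x in lebesgue. x \<notin> ball (fst i) (snd i) - E \<or> x \<notin> ball (fst j) (snd j) - E"
        by (intro AE_I2) (auto simp: disjnt_iff)
    qed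
    also have "\<dots> \<le> measure lebesgue (U - E)"
    proof (rule measure_mono_fmeasurable [OF _ _ U(3)])
      show "(\<Union>i\<in>I. ball (fst i) (snd i) - E) \<subseteq> U - E"
        using I(1) C(2) unfolding K_def by fastforce
      show "(\<Union>i\<in>I. ball (fst i) (snd i) - E) \<in> sets lebesgue"
        using I(2) lm by (intro sets.finite_UN) auto
    qed
    finally show ?thesis
      using mU \<open>k > 0\<close> by (simp add: field_simps)
  qed
  have W: "W \<in> lmeasurable" "measure lebesgue W \<le> e / 2"
    unfolding W_def
    using fmeasurable_UN_bound [OF C(1) _ bound] measure_UN_bound [OF C(1) _ bound] by simp_all
  show "\<exists>T. S \<subseteq> T \<and> T \<in> lmeasurable \<and> measure lebesgue T < e"
  proof (intro exI conjI)
    have N: "S - W \<in> null_sets lebesgue"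
      using cov by (simp add: W_def negligible_iff_null_sets)
    show "S \<subseteq> W \<union> (S - W)" by auto
    show "W \<union> (S - W) \<in> lmeasurable"
      using W(1) fmeasurableI_null_sets [OF N] by (rule fmeasurable.Un)
    have "measure lebesgue (W \<union> (S - W)) = measure lebesgue W"
      using fmeasurableD [OF W(1)] N by (rule measure_Un_null_set)
    then show "measure lebesgue (W \<union> (S - W)) < e"
      using W(2) \<open>e > 0\<close> by simp
  qed
qed

lemma measure_Int_plus_Diff_ball:
  fixes E :: "'a::euclidean_space set"
  assumes "E \<in> sets lebesgue"
  shows "measure lebesgue (E \<inter> ball x \<rho>) + measure lebesgue (ball x \<rho> - E) = measure lebesgue (ball x \<rho>)"
proof -
  have "ball x \<rho> \<inter> E \<in> lmeasurable" "ball x \<rho> - E \<in> lmeasurable"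
    using assms by (simp_all add: fmeasurable_Int_fmeasurable fmeasurable_Diff)
  moreover have "ball x \<rho> \<inter> E \<inter> (ball x \<rho> - E) = {}" by auto
  ultimately have "measure lebesgue ((ball x \<rho> \<inter> E) \<union> (ball x \<rho> - E))
      = measure lebesgue (ball x \<rho> \<inter> E) + measure lebesgue (ball x \<rho> - E)"
    by (simp add: measure_Un3)
  moreover have "(ball x \<rho> \<inter> E) \<union> (ball x \<rho> - E) = ball x \<rho>" by auto
  ultimately show ?thesis by (simp add: Int_commute)
qed

text \<open>
  A point of \<open>E\<close> that is not a density point sees, for some \<open>n\<close>, arbitrarily small balls of which a
  fraction of at least \<open>1 / Suc n\<close> lies outside \<open>E\<close>; the exceptional set is thus a countable union
  of sets that the covering argument shows to be null.
\<close>

theorem lebesgue_density: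
  fixes E :: "(real ^ 'n) set"
  assumes E: "E \<in> sets lebesgue"
  shows "negligible (E - density_one_points E)"
proof -
  define S where "S n = {x \<in> E. \<forall>d>0. \<exists>\<rho>. 0 < \<rho> \<and> \<rho> < d \<and>
      measure lebesgue (ball x \<rho>) \<le> real (Suc n) * measure lebesgue (ball x \<rho> - E)}" for n
  have "negligible (S n)" for n
    by (rule frequently_dense_complement_negligible [OF E, of "real (Suc n)"]) (auto simp: S_def)
  then have "negligible (\<Union>n. S n)"
    by (intro negligible_countable_Union) auto
  moreover have "E - density_one_points E \<subseteq> (\<Union>n. S n)"
  proof
    fix x assume x: "x \<in> E - density_one_points E"
    let ?q = "\<lambda>\<rho>. measure lebesgue (E \<inter> ball x \<rho>) / measure lebesgue (ball x \<rho>)"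
    obtain e where "e > 0" and e: "\<not> eventually (\<lambda>\<rho>. dist (?q \<rho>) 1 < e) (at_right 0)"
      using x by (auto simp: density_one_points_def tendsto_iff)
    obtain n where n: "inverse (real (Suc n)) < e"
      using reals_Archimedean [OF \<open>e > 0\<close>] by auto
    have "\<exists>\<rho>. 0 < \<rho> \<and> \<rho> < d \<and>
        measure lebesgue (ball x \<rho>) \<le> real (Suc n) * measure lebesgue (ball x \<rho> - E)" if "d > 0" for d
    proof -
      obtain \<rho> where \<rho>: "0 < \<rho>" "\<rho> < d" "\<not> dist (?q \<rho>) 1 < e"
        using e \<open>d > 0\<close> unfolding eventually_at_right_field by blast
      have pos: "measure lebesgue (ball x \<rho>) > 0"
        using \<rho>(1) by (simp add: content_ball_pos)
      have "?q \<rho> = 1 - measure lebesgue (ball x \<rho> - E) / measure lebesgue (ball x \<rho>)"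
        using measure_Int_plus_Diff_ball [OF E, of x \<rho>] pos by (simp add: field_simps)
      then have "e \<le> measure lebesgue (ball x \<rho> - E) / measure lebesgue (ball x \<rho>)"
        using \<rho>(3) by (simp add: dist_real_def)
      then have "inverse (real (Suc n)) \<le> measure lebesgue (ball x \<rho> - E) / measure lebesgue (ball x \<rho>)"
        using n by linarith
      then show ?thesis
        using \<rho> pos by (intro exI [of _ \<rho>]) (simp add: field_simps)
    qed
    then have "x \<in> S n" using x by (auto simp: S_def)
    then show "x \<in> (\<Union>n. S n)" by auto
  qed
  ultimately show ?thesis by (rule negligible_subset)
qed

lemma density_one_points_disjoint_Compl:
  fixes E :: "(real ^ 'n) set"
  assumes E: "E \<in> sets lebesgue"
  shows "density_one_points E \<inter> density_one_points (- E) = {}"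
proof (rule ccontr)
  let ?q = "\<lambda>A x \<rho>. measure lebesgue (A \<inter> ball x \<rho>) / measure lebesgue (ball x \<rho>)"
  assume "\<not> ?thesis"
  then obtain x where "(?q E x \<longlongrightarrow> 1) (at_right 0)" "(?q (- E) x \<longlongrightarrow> 1) (at_right 0)"
    by (auto simp: density_one_points_def)
  then have "((\<lambda>\<rho>. ?q E x \<rho> + ?q (- E) x \<rho>) \<longlongrightarrow> 1 + 1) (at_right 0)"
    by (rule tendsto_add)
  moreover have "eventually (\<lambda>\<rho>. ?q E x \<rho> + ?q (- E) x \<rho> = 1) (at_right 0)"
    unfolding eventually_at_right_field
  proof (intro exI [of _ 1] conjI allI impI)
    fix \<rho> :: real assume "0 < \<rho>"
    then have "measure lebesgue (ball x \<rho>) > 0" by (simp add: content_ball_pos)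
    moreover have "- E \<inter> ball x \<rho> = ball x \<rho> - E" by auto
    ultimately show "?q E x \<rho> + ?q (- E) x \<rho> = 1"
      using measure_Int_plus_Diff_ball [OF E, of x \<rho>] by (simp add: add_divide_distrib [symmetric])
  qed simp
  ultimately have "((\<lambda>\<rho>. 1) \<longlongrightarrow> (1 + 1 :: real)) (at_right (0::real))"
    by (rule Lim_transform_eventually)
  then show False
    by (simp add: tendsto_const_iff)
qed

section \<open>Points near which a set is null\<close>

text \<open>
  \<open>null_region E\<close> is the complement of the support of Lebesgue measure restricted to \<open>E\<close>. Applied to \<open>- E\<close>, it
  gives the points near which \<open>E\<close> has full measure, and so serves as interior and exterior of \<open>E\<close>
  modulo null sets.
\<close>

definition null_region :: "'a::euclidean_space set \<Rightarrow> 'a set" where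
  "null_region E = {x. \<exists>\<rho>>0. negligible (E \<inter> ball x \<rho>)}"

lemma null_region_antimono: "A \<subseteq> B \<Longrightarrow> null_region B \<subseteq> null_region A"
  unfolding null_region_def using negligible_subset by (smt (verit) Collect_mono Int_mono subset_refl)

lemma open_null_region: "open (null_region E)"
  unfolding open_contains_ball
proof
  fix x assume "x \<in> null_region E"
  then obtain \<rho> where \<rho>: "\<rho> > 0" "negligible (E \<inter> ball x \<rho>)"
    by (auto simp: null_region_def)
  have "y \<in> null_region E" if y: "y \<in> ball x \<rho>" for y
  proof -
    obtain e where "e > 0" "ball y e \<subseteq> ball x \<rho>"
      using y open_contains_ball by blast
    then show ?thesis
      unfolding null_region_def using \<rho>(2) by (blast intro: negligible_subset)
  qed
  with \<rho>(1) show "\<exists>e>0. ball x e \<subseteq> null_region E" by blast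
qed

lemma null_region_disjoint_Compl: "null_region E \<inter> null_region (- E) = {}"
proof (rule ccontr)
  assume "\<not> ?thesis"
  then obtain x a b where "a > 0" "b > 0"
      and neg: "negligible (E \<inter> ball x a)" "negligible (- E \<inter> ball x b)"
    by (auto simp: null_region_def)
  have "ball x (min a b) \<subseteq> (E \<inter> ball x a) \<union> (- E \<inter> ball x b)" by auto
  then have "negligible (ball x (min a b))"
    using neg by (meson negligible_Un negligible_subset)
  moreover have "\<not> negligible (ball x (min a b))"
    using \<open>a > 0\<close> \<open>b > 0\<close> by (intro open_not_negligible) auto
  ultimately show False by blast
qed

lemma negligible_if_null_region_UNIV:
  assumes "null_region E = UNIV"
  shows "negligible E"
  unfolding locally_negligible_alt [of E]
proof
  fix x assume "x \<in> E"
  have "x \<in> null_region E" using assms by simp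
  then obtain \<rho> where "\<rho> > 0" "negligible (E \<inter> ball x \<rho>)"
    by (auto simp: null_region_def)
  then show "\<exists>U. openin (top_of_set E) U \<and> x \<in> U \<and> negligible U"
    using \<open>x \<in> E\<close> by (intro exI [of _ "E \<inter> ball x \<rho>"]) (simp add: openin_open_Int)
qed

lemma null_region_Compl_subset_density_one_points:
  fixes E :: "(real ^ 'n) set"
  assumes E: "E \<in> sets lebesgue"
  shows "null_region (- E) \<subseteq> density_one_points E"
proof
  fix x assume "x \<in> null_region (- E)"
  then obtain d where "d > 0" and d: "negligible (- E \<inter> ball x d)"
    by (auto simp: null_region_def)
  have "eventually (\<lambda>\<rho>. 1 = measure lebesgue (E \<inter> ball x \<rho>) / measure lebesgue (ball x \<rho>)) (at_right 0)"
    unfolding eventually_at_right_field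
  proof (intro exI [of _ d] conjI allI impI)
    fix \<rho> :: real assume \<rho>: "0 < \<rho>" "\<rho> < d"
    then have "ball x \<rho> - E \<subseteq> - E \<inter> ball x d" by auto
    then have "measure lebesgue (ball x \<rho> - E) = 0"
      using d by (meson negligible_imp_measure0 negligible_subset)
    moreover have "measure lebesgue (ball x \<rho>) > 0"
      using \<rho>(1) by (simp add: content_ball_pos)
    ultimately show "1 = measure lebesgue (E \<inter> ball x \<rho>) / measure lebesgue (ball x \<rho>)"
      using measure_Int_plus_Diff_ball [OF E, of x \<rho>] by simp
  qed (use \<open>d > 0\<close> in simp)
  then show "x \<in> density_one_points E"
    unfolding density_one_points_def mem_Collect_eq
    by (rule Lim_transform_eventually [OF tendsto_const])
qed

text \<open>
  This is the only place where the density theorem enters: positive measure in every neighbourhood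
  forces genuine density points in every neighbourhood.
\<close>

lemma density_one_points_near:
  fixes E :: "(real ^ 'n) set"
  assumes E: "E \<in> sets lebesgue" and "x \<notin> null_region E" "\<rho> > 0"
  shows "\<exists>y \<in> density_one_points E. dist x y < \<rho>"
proof (rule ccontr)
  assume "\<not> ?thesis"
  then have "E \<inter> ball x \<rho> \<subseteq> E - density_one_points E" by auto
  then have "negligible (E \<inter> ball x \<rho>)"
    using lebesgue_density [OF E] by (rule negligible_subset [rotated])
  with assms show False by (auto simp: null_region_def)
qed

text \<open>
  A point of \<open>null_region E\<close> has a neighbourhood of density points of \<open>- E\<close>, and symmetrically,
  so neither region meets the boundary. At any other point, both \<open>E\<close> and \<open>- E\<close> have density points
  nearby. This description makes the symmetry under complements visible, and each of the two
  regions varies monotonically with \<open>E\<close>.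
\<close>

lemma density_boundary_eq:
  fixes E :: "(real ^ 'n) set"
  assumes E: "E \<in> sets lebesgue"
  shows "density_boundary E = - (null_region E \<union> null_region (- E))"
proof (intro set_eqI iffI)
  have E': "- E \<in> sets lebesgue" using E by (simp add: Compl_in_sets_lebesgue)
  note disj = density_one_points_disjoint_Compl [OF E]
  have sub1: "null_region (- E) \<subseteq> density_one_points E"
    using E by (rule null_region_Compl_subset_density_one_points)
  have sub2: "null_region E \<subseteq> density_one_points (- E)"
    using null_region_Compl_subset_density_one_points [OF E'] by simp
  fix x
  {
    assume x: "x \<in> density_boundary E"
    have "null_region (- E) \<subseteq> interior (density_one_points E)"
      using sub1 open_null_region by (rule interior_maximal)
    then have "x \<notin> null_region (- E)"
      using x by (auto simp: density_boundary_def frontier_def)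
    moreover have "x \<notin> null_region E"
    proof
      assume "x \<in> null_region E"
      then obtain e where "e > 0" "ball x e \<subseteq> null_region E"
        using open_null_region open_contains_ball by blast
      moreover obtain y where "y \<in> density_one_points E" "dist x y < e"
        using x \<open>e > 0\<close> unfolding density_boundary_def frontier_straddle by blast
      ultimately have "y \<in> null_region E" by auto
      then show False
        using sub2 disj \<open>y \<in> density_one_points E\<close> by blast
    qed
    ultimately show "x \<in> - (null_region E \<union> null_region (- E))" by simp
  next
    assume x: "x \<in> - (null_region E \<union> null_region (- E))"
    show "x \<in> density_boundary E"
      unfolding density_boundary_def frontier_straddle
    proof (intro CollectI allI impI conjI)
      fix e :: real assume "e > 0"
      show "\<exists>y\<in>density_one_points E. dist x y < e"
        using density_one_points_near [OF E] x \<open>e > 0\<close> by auto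
      show "\<exists>y. y \<notin> density_one_points E \<and> dist x y < e"
        using density_one_points_near [OF E'] x \<open>e > 0\<close> disj by blast
    qed
  }
qed

lemma density_boundary_Compl:
  fixes E :: "(real ^ 'n) set"
  assumes E: "E \<in> sets lebesgue"
  shows "density_boundary (- E) = density_boundary E"
proof -
  have "- E \<in> sets lebesgue" using E by (simp add: Compl_in_sets_lebesgue)
  then show ?thesis
    using E by (simp add: density_boundary_eq Un_commute)
qed

lemma closed_density_boundary: "closed (density_boundary E)"
  by (simp add: density_boundary_def)

lemma connected_meets_density_boundary:
  fixes E :: "(real ^ 'n) set"
  assumes E: "E \<in> sets lebesgue" and "connected S"
    and "x \<in> S" "x \<notin> null_region E" and "y \<in> S" "y \<in> null_region E"
  shows "S \<inter> density_boundary E \<noteq> {}"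
proof
  assume "S \<inter> density_boundary E = {}"
  then have "S \<subseteq> null_region E \<union> null_region (- E)"
    using density_boundary_eq [OF E] by blast
  then show False
    using connectedD [OF \<open>connected S\<close> open_null_region open_null_region, of E "- E"]
      null_region_disjoint_Compl [of E] assms by blast
qed

section \<open>Carving a ball out of a set\<close>

lemma open_ball_enlargement: "open (ball_enlargement A r)"
  by (auto simp: ball_enlargement_def)

text \<open>
  The hypothesis \<open>cover\<close> is what prevents new boundary on the sphere from enlarging the perimeter:
  a point of the ball near which \<open>E\<close> is full is assumed to be counted already, and any other point
  close to new boundary is separated from it by old boundary. The radius \<open>2 * r\<close> leaves \<open>ball c r\<close>
  at distance at least \<open>r\<close> from everything outside the carved ball, so that all of \<open>ball c r\<close> drops
  out of the enlarged boundary; the hypothesis \<open>meets\<close> says that this is a real loss.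
\<close>

lemma Per_carve_ball_less:
  fixes E :: "(real ^ 'n) set"
  assumes E: "E \<in> sets lebesgue" and "r > 0"
    and meets: "ball c r \<inter> ball_enlargement (density_boundary E) r \<noteq> {}"
    and cover: "ball c (2 * r) \<inter> null_region (- E) \<subseteq> ball_enlargement (density_boundary E) r"
  shows "Per r (E - ball c (2 * r)) (ball c (2 * r)) < Per r E (ball c (2 * r))"
proof -
  define B where "B = ball c (2 * r)"
  define F where "F = E - B"
  let ?V = "\<lambda>A. ball_enlargement (density_boundary A) r"
  have F: "F \<in> sets lebesgue" using E by (auto simp: F_def B_def)
  have "B \<subseteq> null_region F"
  proof
    fix x assume "x \<in> B"
    then obtain e where "e > 0" "ball x e \<subseteq> B"
      unfolding B_def using open_contains_ball open_ball by blast
    moreover from this have "F \<inter> ball x e = {}" by (auto simp: F_def)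
    ultimately show "x \<in> null_region F"
      unfolding null_region_def by (metis (mono_tags) mem_Collect_eq negligible_empty)
  qed
  then have F_out: "density_boundary F \<inter> B = {}"
    using density_boundary_eq [OF F] by blast
  have F_sub: "density_boundary F \<subseteq> density_boundary E \<union> null_region (- E)"
    using density_boundary_eq [OF F] density_boundary_eq [OF E] null_region_antimono [of F E]
    by (auto simp: F_def)
  have incl: "?V F \<inter> B \<subseteq> ?V E"
  proof
    fix x assume "x \<in> ?V F \<inter> B"
    then obtain q where q: "q \<in> density_boundary F" "dist q x < r" and "x \<in> B"
      by (auto simp: ball_enlargement_def)
    \<comment> \<open>In the last case \<open>q\<close> is new boundary and the segment to \<open>x\<close> leaves the region where \<open>E\<close>
      is full.\<close>
    consider "q \<in> density_boundary E" | "x \<in> null_region (- E)"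
      | "q \<in> null_region (- E)" "x \<notin> null_region (- E)"
      using q(1) F_sub by blast
    then show "x \<in> ?V E"
    proof cases
      case 1
      then show ?thesis using q(2) by (auto simp: ball_enlargement_def)
    next
      case 2
      then show ?thesis using cover \<open>x \<in> B\<close> by (auto simp: B_def)
    next
      case 3
      have "- E \<in> sets lebesgue" using E by (simp add: Compl_in_sets_lebesgue)
      then have "closed_segment q x \<inter> density_boundary (- E) \<noteq> {}"
        by (rule connected_meets_density_boundary [where x = x and y = q]) (use 3 in auto)
      then obtain y where "y \<in> closed_segment q x" "y \<in> density_boundary E"
        using density_boundary_Compl [OF E] by blast
      moreover from this have "dist y x < r"
        using q(2) dist_in_closed_segment [of y q x] by (simp add: dist_commute)
      ultimately show ?thesis by (auto simp: ball_enlargement_def)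
    qed
  qed
  have F_far: "?V F \<inter> ball c r = {}"
  proof (rule ccontr)
    assume "\<not> ?thesis"
    then obtain q x where "q \<in> density_boundary F" "dist q x < r" "dist c x < r"
      by (auto simp: ball_enlargement_def)
    moreover from this have "dist c q < 2 * r"
      using dist_triangle2 [of c q x] by simp
    ultimately show False using F_out by (auto simp: B_def)
  qed
  \<comment> \<open>A part of the enlarged boundary that carving removes.\<close>
  define L where "L = ball c r \<inter> ?V E"
  have "L \<subseteq> B" using \<open>r > 0\<close> by (auto simp: L_def B_def)
  have "open L" "L \<noteq> {}"
    using meets by (auto simp: L_def open_ball_enlargement)
  then have "\<not> negligible L" by (rule open_not_negligible)
  moreover have lm: "A \<inter> B \<in> lmeasurable" if "open A" for A
    using that by (simp add: B_def bounded_Int lmeasurable_open open_Int)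
  moreover have "L \<in> lmeasurable"
    using lm [OF \<open>open L\<close>] \<open>L \<subseteq> B\<close> by (simp add: Int_absorb2)
  ultimately have L: "L \<in> lmeasurable" "measure lebesgue L > 0"
    by (auto simp: negligible_iff_measure0 zero_less_measure_iff negligible_iff_measure measure_nonneg le_less)
  have "?V F \<inter> B \<inter> L = {}"
    using F_far by (auto simp: L_def)
  then have "measure lebesgue (?V F \<inter> B) + measure lebesgue L = measure lebesgue ((?V F \<inter> B) \<union> L)"
    using L(1) lm [OF open_ball_enlargement] by (simp add: measure_Un3)
  also have "\<dots> \<le> measure lebesgue (?V E \<inter> B)"
    using incl \<open>L \<subseteq> B\<close> L(1) lm [OF open_ball_enlargement]
    by (intro measure_mono_fmeasurable) (auto simp: L_def)
  finally have "measure lebesgue (?V F \<inter> B) < measure lebesgue (?V E \<inter> B)"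
    using L(2) by linarith
  then have "Per r F B < Per r E B"
    using lm [OF open_ball_enlargement] \<open>r > 0\<close>
    by (simp add: Per_def emeasure_eq_measure2 divide_ennreal ennreal_less_iff divide_strict_right_mono)
  then show ?thesis by (simp add: F_def B_def)
qed

lemma exists_point_at_infdist:
  fixes S :: "'a::euclidean_space set"
  assumes "S \<noteq> {}" "r \<ge> 0" "infdist z S \<ge> r"
  obtains c where "infdist c S = r"
proof -
  obtain p where "p \<in> S" using \<open>S \<noteq> {}\<close> by blast
  have "connected (range (\<lambda>x. infdist x S))"
    by (intro connected_continuous_image continuous_intros connected_UNIV)
  then have "{infdist p S..infdist z S} \<subseteq> range (\<lambda>x. infdist x S)"
    by (rule connected_contains_Icc) auto
  moreover have "infdist p S = 0" using \<open>p \<in> S\<close> by simp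
  ultimately have "r \<in> range (\<lambda>x. infdist x S)" using assms by auto
  then show ?thesis using that by (metis imageE)
qed

text \<open>
  A centre at distance exactly \<open>r\<close> from the boundary works: boundary crossed on the way from \<open>c\<close> to
  a point at distance less than \<open>2 * r\<close> has distance at least \<open>r\<close> from \<open>c\<close>, and so less than \<open>r\<close>
  remains. Such a crossing exists because \<open>A\<close> is chosen among \<open>E\<close> and \<open>- E\<close> not to be full near \<open>c\<close>.
\<close>

lemma exists_carvable_ball:
  fixes E :: "(real ^ 'n) set"
  assumes E: "E \<in> sets lebesgue" and "r > 0" and ne: "density_boundary E \<noteq> {}"
  obtains c A where "A = E \<or> A = - E"
    "ball c r \<inter> ball_enlargement (density_boundary A) r \<noteq> {}"
    "ball c (2 * r) \<inter> null_region (- A) \<subseteq> ball_enlargement (density_boundary A) r"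
proof (cases "ball_enlargement (density_boundary E) r = UNIV")
  case True
  then show ?thesis
    using that [of E "0"] \<open>r > 0\<close> by auto
next
  case False
  define \<Gamma> where "\<Gamma> = density_boundary E"
  have \<Gamma>: "closed \<Gamma>" "\<Gamma> \<noteq> {}"
    using ne by (simp_all add: \<Gamma>_def closed_density_boundary)
  obtain z where "z \<notin> ball_enlargement \<Gamma> r" using False by (auto simp: \<Gamma>_def)
  then have "infdist z \<Gamma> \<ge> r"
    using infdist_attains_inf [OF \<Gamma>, of z]
    by (force simp: ball_enlargement_def dist_commute not_less)
  then obtain c where c: "infdist c \<Gamma> = r"
    using exists_point_at_infdist [OF \<Gamma>(2), of r z] \<open>r > 0\<close> by auto
  have far: "dist c y \<ge> r" if "y \<in> \<Gamma>" for y
    using infdist_le [OF that, of c] c by simp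
  obtain p where p: "p \<in> \<Gamma>" "dist c p = r"
    using infdist_attains_inf [OF \<Gamma>, of c] c by metis
  \<comment> \<open>\<open>p\<close> itself lies on the sphere, but the midpoint has distance \<open>r / 2\<close> from both \<open>c\<close> and \<open>p\<close>.\<close>
  have "midpoint c p \<in> ball c r \<inter> ball_enlargement \<Gamma> r"
    using p \<open>r > 0\<close> dist_midpoint(1,4) [of c p]
    by (simp add: ball_enlargement_def dist_commute) (intro bexI [of _ p], simp_all)
  then have meets: "ball c r \<inter> ball_enlargement \<Gamma> r \<noteq> {}" by blast
  have "c \<notin> null_region (- E) \<or> c \<notin> null_region (- (- E))"
    using null_region_disjoint_Compl [of E] by auto
  then obtain A where A: "A = E \<or> A = - E" "c \<notin> null_region (- A)" by blast
  have A': "- A \<in> sets lebesgue"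
    using A(1) E Compl_in_sets_lebesgue [of E] by auto
  have "density_boundary A = \<Gamma> \<and> density_boundary (- A) = \<Gamma>"
    using A(1)
  proof
    assume "A = E"
    then show ?thesis using density_boundary_Compl [OF E] by (simp add: \<Gamma>_def)
  next
    assume "A = - E"
    then show ?thesis using density_boundary_Compl [OF E] by (simp add: \<Gamma>_def)
  qed
  then have bdA: "density_boundary A = \<Gamma>" "density_boundary (- A) = \<Gamma>" by auto
  have "ball c (2 * r) \<inter> null_region (- A) \<subseteq> ball_enlargement \<Gamma> r"
  proof
    fix x assume x: "x \<in> ball c (2 * r) \<inter> null_region (- A)"
    have "closed_segment c x \<inter> density_boundary (- A) \<noteq> {}"
      by (rule connected_meets_density_boundary [OF A', where x = c and y = x]) (use x A in auto)
    then obtain y where y: "y \<in> closed_segment c x" "y \<in> \<Gamma>"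
      using bdA(2) by blast
    have "dist c x = dist c y + dist y x"
      using y(1) by (simp flip: between_mem_segment add: between)
    then have "dist y x < r" using far [OF y(2)] x by simp
    then show "x \<in> ball_enlargement \<Gamma> r"
      using y(2) by (auto simp: ball_enlargement_def)
  qed
  then show ?thesis using that [OF A(1), of c] meets bdA(1) by simp
qed

theorem proposition1p3:
  fixes r :: real and E :: "(real ^ 'n) set"
  assumes "r > 0"
    and "E \<in> sets lebesgue"
    and "\<And>x \<rho> F. \<rho> > 0 \<Longrightarrow> F \<in> sets lebesgue \<Longrightarrow> eq_ae (F - ball x \<rho>) (E - ball x \<rho>) \<Longrightarrow>
           Per r E (ball x \<rho>) \<le> Per r F (ball x \<rho>)"
  shows "eq_ae E {} \<or> eq_ae E UNIV"
proof (cases "density_boundary E = {}")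
  case True
  then have cover: "null_region E \<union> null_region (- E) = UNIV"
    using density_boundary_eq [OF assms(2)] by blast
  then have "null_region E = {} \<or> null_region (- E) = {}"
    using connectedD [OF connected_UNIV open_null_region open_null_region, of E "- E"]
      null_region_disjoint_Compl [of E] by auto
  then have "null_region (- E) = UNIV \<or> null_region E = UNIV"
    using cover by auto
  then have "negligible (- E) \<or> negligible E"
    using negligible_if_null_region_UNIV by blast
  then show ?thesis
    by (auto simp: eq_ae_def negligible_iff_null_sets Compl_eq_Diff_UNIV)
next
  case False
  obtain c A where A: "A = E \<or> A = - E"
      "ball c r \<inter> ball_enlargement (density_boundary A) r \<noteq> {}"
      "ball c (2 * r) \<inter> null_region (- A) \<subseteq> ball_enlargement (density_boundary A) r"
    using exists_carvable_ball [OF assms(2,1) False] .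
  define B where "B = ball c (2 * r)"
  have A_meas: "A \<in> sets lebesgue"
    using A(1) assms(2) Compl_in_sets_lebesgue [of E] by auto
  then have AB_meas: "A - B \<in> sets lebesgue"
    unfolding B_def by (intro sets.Diff) auto
  have less: "Per r (A - B) B < Per r A B"
    unfolding B_def using Per_carve_ball_less [OF A_meas assms(1) A(2,3)] .
  from A(1) have "\<exists>F. F \<in> sets lebesgue \<and> F - B = E - B \<and> Per r F B < Per r E B"
  proof
    assume "A = E"
    then show ?thesis using less AB_meas by blast
  next
    \<comment> \<open>Carving the ball out of \<open>- E\<close> amounts to filling it into \<open>E\<close>, and a set and its complement
      have the same boundary.\<close>
    assume "A = - E"
    then have "Per r (- (A - B)) B < Per r E B"
      using less density_boundary_Compl [OF AB_meas] density_boundary_Compl [OF assms(2)]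
      by (simp add: Per_def)
    moreover have "- (A - B) - B = E - B" using \<open>A = - E\<close> by auto
    ultimately show ?thesis using AB_meas Compl_in_sets_lebesgue [of "A - B"] by blast
  qed
  then obtain F where F: "F \<in> sets lebesgue" "F - B = E - B" "Per r F B < Per r E B" by blast
  then have "Per r E B \<le> Per r F B"
    using assms(3) [of "2 * r" F c] assms(1) by (simp add: B_def eq_ae_def)
  with F(3) show ?thesis by simp
qed

end
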